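(* Let $G$ be a connected regular graph of order $n\geq 5$ and let $C(G)$ be its central graph. Then: (1) If $n$ is odd, then $\chi''_{D}(C(G))=\Delta(C(G))+1$. (2) If $n$ is even, $G$ is not isomorphic to the complete graph $K_n$, and $\Delta(G)\leq \frac{2n-29}{6}$, then $\chi''_{D}(C(G))=\Delta(C(G))+1$. Consequently, if $G$ satisfies the hypotheses of (1) or (2), then $C(G)$ is of Type 1, i.e. $\chi''(C(G))=\Delta(C(G))+1$.
   Context: All graphs are simple, finite, undirected. The central graph $C(G)$ has vertex set $V(G)\cup\{w_{u,v}:\{u,v\}\in E(G)\}$ and edge set consisting of all pairs $\{u,v\}$ of distinct non-adjacent vertices of $G$, together with $\{u,w_{u,v}\}$ and $\{w_{u,v},v\}$ for every $\{u,v\}\in E(G)$. $\Delta(H)$ is the maximum degree. A total coloring colors vertices and edges; it is proper if adjacent vertices, adjacent edges, and incident vertex-edge pairs get different colors. $\chi''(H)$ is the least number of colors in a proper total coloring of $H$. An automorphism $\phi$ preserves a total coloring $f$ if $f(\phi(x))=f(x)$ for all vertices and edges $x$; $\chi''_D(H)$ is the least $d$ such that $H$ has a proper total coloring with $d$ colors preserved only by the identity automorphism. *)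

theory Defs imports Complex_Main begin

record 'a graph =
  vertices :: "'a set"
  edges :: "'a set set"

definition finite_simple_graph :: "'a graph \<Rightarrow> bool" where
  "finite_simple_graph G \<longleftrightarrow> finite (vertices G) \<and>
     (\<forall>e\<in>edges G. e \<subseteq> vertices G \<and> card e = 2)"

definition graph_order :: "'a graph \<Rightarrow> nat" where
  "graph_order G = card (vertices G)"

definition connected_graph :: "'a graph \<Rightarrow> bool" where
  "connected_graph G \<longleftrightarrow> vertices G \<noteq> {} \<and>
     (\<forall>u\<in>vertices G. \<forall>v\<in>vertices G. (u, v) \<in> {(x, y). {x, y} \<in> edges G}\<^sup>*)"

definition vertex_degree :: "'a graph \<Rightarrow> 'a \<Rightarrow> nat" where
  "vertex_degree G v = card {e \<in> edges G. v \<in> e}"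

definition max_degree :: "'a graph \<Rightarrow> nat" where
  "max_degree G = Max (vertex_degree G ` vertices G)"

definition regular_graph :: "'a graph \<Rightarrow> bool" where
  "regular_graph G \<longleftrightarrow> (\<exists>k. \<forall>v\<in>vertices G. vertex_degree G v = k)"

definition graph_isomorphism :: "'a graph \<Rightarrow> 'b graph \<Rightarrow> ('a \<Rightarrow> 'b) \<Rightarrow> bool" where
  "graph_isomorphism G H \<phi> \<longleftrightarrow> bij_betw \<phi> (vertices G) (vertices H) \<and>
     (\<forall>u\<in>vertices G. \<forall>v\<in>vertices G. {u, v} \<in> edges G \<longleftrightarrow> {\<phi> u, \<phi> v} \<in> edges H)"

definition graph_isomorphic :: "'a graph \<Rightarrow> 'b graph \<Rightarrow> bool" where
  "graph_isomorphic G H \<longleftrightarrow> (\<exists>\<phi>. graph_isomorphism G H \<phi>)"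

abbreviation automorphism :: "'a graph \<Rightarrow> ('a \<Rightarrow> 'a) \<Rightarrow> bool" where
  "automorphism G \<equiv> graph_isomorphism G G"

definition complete_graph :: "nat \<Rightarrow> nat graph" where
  "complete_graph n = \<lparr>vertices = {..<n}, edges = {{i, j} | i j. i < n \<and> j < n \<and> i \<noteq> j}\<rparr>"

text \<open>The vertex \<open>Subdiv {u, v}\<close> of the central graph is the new vertex $w_{u,v}$
  subdividing the edge \<open>{u, v}\<close>; \<open>Orig v\<close> is the vertex \<open>v\<close> of the given graph.\<close>

datatype 'a central_vertex = Orig 'a | Subdiv "'a set"

definition central_graph :: "'a graph \<Rightarrow> 'a central_vertex graph" where
  "central_graph G = \<lparr>
     vertices = Orig ` vertices G \<union> Subdiv ` edges G,
     edges = {{Orig u, Orig v} | u v. u \<in> vertices G \<and> v \<in> vertices G \<and> u \<noteq> v \<and> {u, v} \<notin> edges G}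
           \<union> {{Orig u, Subdiv e} | u e. e \<in> edges G \<and> u \<in> e}\<rparr>"

text \<open>A total coloring is a function on vertices (\<open>Inl v\<close>) and edges (\<open>Inr e\<close>);
  only its values on \<open>vertices H <+> edges H\<close> matter. The available colors are
  \<open>0, \<dots>, d - 1\<close>; they need not all be used, which does not affect the least \<open>d\<close>.\<close>

definition proper_total_coloring :: "'a graph \<Rightarrow> nat \<Rightarrow> ('a + 'a set \<Rightarrow> nat) \<Rightarrow> bool" where
  "proper_total_coloring H d f \<longleftrightarrow>
     (\<forall>x \<in> vertices H <+> edges H. f x < d) \<and>
     (\<forall>u\<in>vertices H. \<forall>v\<in>vertices H. u \<noteq> v \<and> {u, v} \<in> edges H \<longrightarrow> f (Inl u) \<noteq> f (Inl v)) \<and>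
     (\<forall>e\<in>edges H. \<forall>e'\<in>edges H. e \<noteq> e' \<and> e \<inter> e' \<noteq> {} \<longrightarrow> f (Inr e) \<noteq> f (Inr e')) \<and>
     (\<forall>v\<in>vertices H. \<forall>e\<in>edges H. v \<in> e \<longrightarrow> f (Inl v) \<noteq> f (Inr e))"

definition preserves_coloring :: "'a graph \<Rightarrow> ('a \<Rightarrow> 'a) \<Rightarrow> ('a + 'a set \<Rightarrow> nat) \<Rightarrow> bool" where
  "preserves_coloring H \<phi> f \<longleftrightarrow>
     (\<forall>v\<in>vertices H. f (Inl (\<phi> v)) = f (Inl v)) \<and>
     (\<forall>e\<in>edges H. f (Inr (\<phi> ` e)) = f (Inr e))"

definition distinguishing :: "'a graph \<Rightarrow> ('a + 'a set \<Rightarrow> nat) \<Rightarrow> bool" where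
  "distinguishing H f \<longleftrightarrow>
     (\<forall>\<phi>. automorphism H \<phi> \<and> preserves_coloring H \<phi> f \<longrightarrow> (\<forall>v\<in>vertices H. \<phi> v = v))"

definition total_chromatic_number :: "'a graph \<Rightarrow> nat" where
  "total_chromatic_number H = (LEAST d. \<exists>f. proper_total_coloring H d f)"

definition total_distinguishing_chromatic_number :: "'a graph \<Rightarrow> nat" where
  "total_distinguishing_chromatic_number H =
     (LEAST d. \<exists>f. proper_total_coloring H d f \<and> distinguishing H f)"

end

theory Submission imports Defs "HOL-Combinatorics.Transposition" begin

text \<open>Every original vertex has degree $n - 1$ in the central graph, so $n$ colors are necessary.
  To color with $n$ colors, label the vertices of $G$ by residues modulo $n$ and give an edge
  between original vertices $v, w$ the sum of the labels. The color of $v$ is one of the sums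
  with a label from the closed neighborhood of $v$ in $G$; the remaining sums of this kind are
  distributed over the subdivided edges at $v$ in such a way that the two halves of a subdivided
  edge differ. The subdividing vertices, of degree 2, can then be colored greedily as \<open>n \<ge> 5\<close>.
  For odd $n$ the vertex $v$ takes twice its label. For even $n$ antipodal labels collide, which
  is harmless for adjacent vertices; the labels are chosen along a maximum matching, and the
  pairs of unmatched vertices are separated by odd colors.
  In both cases some original vertex has a color of its own. An automorphism preserving the
  coloring fixes it, hence fixes its neighbors since edges at a vertex have distinct colors, and
  so by connectedness is the identity.\<close>


section \<open>Distributing colors over half-edges\<close>

text \<open>Choose \<open>\<sigma>\<close> with the fewest conflicts. At a conflict \<open>{a, b}\<close> of color \<open>c\<close>, exchanging the colors
  that \<open>b\<close> gives to \<open>a\<close> and to another neighbor \<open>m\<close> must create a conflict \<open>{b, m}\<close> of color \<open>c\<close>.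
  As each vertex uses \<open>c\<close> only once, the conflict can be pushed along an arbitrarily long path
  without repeated vertices, contradicting finiteness.\<close>

lemma exists_conflict_free_assignment:
  fixes N :: "'a \<Rightarrow> 'a set" and R :: "'a \<Rightarrow> 'b set"
  assumes fin: "finite V" and sub: "\<And>v. v \<in> V \<Longrightarrow> N v \<subseteq> V"
    and sym: "\<And>v w. v \<in> V \<Longrightarrow> w \<in> N v \<Longrightarrow> v \<in> N w"
    and irr: "\<And>v. v \<in> V \<Longrightarrow> v \<notin> N v"
    and deg: "\<And>v. v \<in> V \<Longrightarrow> 2 \<le> card (N v)"
    and R: "\<And>v. v \<in> V \<Longrightarrow> finite (R v) \<and> card (R v) = card (N v)"
  shows "\<exists>\<sigma>. (\<forall>v\<in>V. bij_betw (\<sigma> v) (N v) (R v)) \<and> (\<forall>v\<in>V. \<forall>w\<in>N v. \<sigma> v w \<noteq> \<sigma> w v)"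
proof -
  define K where "K \<sigma> = {(v, w). v \<in> V \<and> w \<in> N v \<and> \<sigma> v w = \<sigma> w v}" for \<sigma> :: "'a \<Rightarrow> 'a \<Rightarrow> 'b"
  define B where "B \<sigma> \<longleftrightarrow> (\<forall>v\<in>V. bij_betw (\<sigma> v) (N v) (R v))" for \<sigma>
  define Opt where "Opt \<sigma> \<longleftrightarrow> B \<sigma> \<and> (\<forall>\<tau>. B \<tau> \<longrightarrow> card (K \<sigma>) \<le> card (K \<tau>))" for \<sigma>
  have finN: "finite (N v)" if "v \<in> V" for v using sub[OF that] fin finite_subset by blast
  have finK: "finite (K \<sigma>)" for \<sigma>
    by (rule finite_subset[of _ "V \<times> V"]) (use sub fin in \<open>auto simp: K_def\<close>)
  have "\<forall>v\<in>V. \<exists>f. bij_betw f (N v) (R v)"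
    using finN R by (metis finite_same_card_bij)
  then obtain \<sigma>0 where "B \<sigma>0" unfolding B_def by metis
  then obtain \<sigma> where \<sigma>: "Opt \<sigma>"
    using ex_has_least_nat[of B \<sigma>0 "\<lambda>\<sigma>. card (K \<sigma>)"] unfolding Opt_def by blast
  \<comment> \<open>The exchange removes the two ordered pairs of the conflict {a, b} from
    \<open>K\<close> and can add at most the two pairs of {b, m}. By minimality these must really be
    added, and the new assignment is again optimal.\<close>
  have step: "\<sigma> m b = c \<and> Opt (\<sigma>(b := (\<sigma> b)(a := \<sigma> b m, m := c)))"
    if o: "Opt \<sigma>" and b: "b \<in> V" and a: "a \<in> N b" and c: "\<sigma> a b = c" "\<sigma> b a = c"
      and m: "m \<in> N b" "m \<noteq> a" for \<sigma> a b c m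
  proof -
    define \<tau> where "\<tau> = \<sigma>(b := (\<sigma> b)(a := \<sigma> b m, m := c))"
    have aV: "a \<in> V" and mV: "m \<in> V" using a m b sub by auto
    have ne: "a \<noteq> b" "m \<noteq> b" using a m b irr by auto
    have bij: "bij_betw (\<sigma> b) (N b) (R b)" using o b by (auto simp: Opt_def B_def)
    have mc: "\<sigma> b m \<noteq> c"
      using bij a m c by (metis bij_betw_imp_inj_on inj_onD)
    have "bij_betw (\<tau> b) (N b) (R b)"
    proof -
      have "\<tau> b = \<sigma> b \<circ> transpose a m"
        using m c by (auto simp: \<tau>_def transpose_def)
      moreover have "bij_betw (transpose a m) (N b) (N b)"
        using a m by (simp add: bij_betw_transpose_iff)
      ultimately show ?thesis using bij bij_betw_trans by metis
    qed
    then have B: "B \<tau>" using o by (auto simp: Opt_def B_def \<tau>_def)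
    have ab: "(a, b) \<in> K \<sigma>" "(b, a) \<in> K \<sigma>"
      using a b aV sym c by (auto simp: K_def)
    \<comment> \<open>Only the values at \<open>b\<close> have changed, and only those for
      \<open>a\<close> and \<open>m\<close>; since \<open>\<sigma> b m\<close> differs from
      \<open>c\<close>, the conflict with \<open>a\<close> disappears.\<close>
    have sub1: "K \<tau> \<subseteq> (K \<sigma> - {(a, b), (b, a)}) \<union> {(b, m), (m, b)}"
      using mc c ne by (auto simp: K_def \<tau>_def split: if_splits)
    have le: "card (K \<sigma>) \<le> card (K \<tau>)" using o B by (auto simp: Opt_def)
    have mb: "\<sigma> m b = c"
    proof (rule ccontr)
      assume "\<sigma> m b \<noteq> c"
      then have "(b, m) \<notin> K \<tau>" "(m, b) \<notin> K \<tau>"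
        using ne m by (auto simp: K_def \<tau>_def)
      with sub1 have "K \<tau> \<subseteq> K \<sigma> - {(a, b)}" by blast
      then have "K \<tau> \<subset> K \<sigma>" using ab by blast
      then show False using le psubset_card_mono[OF finK] by (metis not_le)
    qed
    have "card (K \<tau>) \<le> card ((K \<sigma> - {(a, b), (b, a)}) \<union> {(b, m), (m, b)})"
      by (rule card_mono) (use sub1 finK in auto)
    also have "\<dots> \<le> card (K \<sigma> - {(a, b), (b, a)}) + card {(b, m), (m, b)}"
      by (rule card_Un_le)
    also have "\<dots> = card (K \<sigma>) - 2 + 2"
      using ab ne by (subst card_Diff_subset) auto
    also have "\<dots> = card (K \<sigma>)"
      using card_mono[OF finK, of "{(a, b), (b, a)}" \<sigma>] ab ne by (auto simp: card_insert_if)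
    finally have "card (K \<tau>) = card (K \<sigma>)" using le by simp
    then have "Opt \<tau>" using o B by (auto simp: Opt_def)
    with mb show ?thesis by (simp add: \<tau>_def)
  qed
  have "K \<sigma> = {}"
  proof (rule ccontr)
    assume "K \<sigma> \<noteq> {}"
    then obtain a b where ab: "a \<in> V" "b \<in> N a" "\<sigma> a b = \<sigma> b a" by (auto simp: K_def)
    define c where "c = \<sigma> a b"
    \<comment> \<open>Invariant: on a path of \<open>t + 2\<close> vertices each vertex gives
      \<open>c\<close> to its successor, and the last edge is a conflict. The assignment varies with
      \<open>t\<close>, since pushing the conflict on alters the vertex that was last.\<close>
    have "\<exists>\<sigma> p. Opt \<sigma> \<and> inj_on p {..Suc t} \<and> p ` {..Suc t} \<subseteq> V \<and>
        (\<forall>i\<le>t. p (Suc i) \<in> N (p i) \<and> \<sigma> (p i) (p (Suc i)) = c) \<and>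
        \<sigma> (p (Suc t)) (p t) = c" for t
    proof (induction t)
      case 0
      define p where "p i = (if i = 0 then a else b)" for i :: nat
      have "{..Suc 0} = {0, Suc 0}" by auto
      then have "inj_on p {..Suc 0}" "p ` {..Suc 0} \<subseteq> V"
        using ab irr sub by (auto simp: p_def)
      moreover have "(\<forall>i\<le>0. p (Suc i) \<in> N (p i) \<and> \<sigma> (p i) (p (Suc i)) = c) \<and>
        \<sigma> (p (Suc 0)) (p 0) = c" using ab by (auto simp: p_def c_def)
      ultimately show ?case using \<sigma> by blast
    next
      case (Suc t)
      then obtain \<sigma> p where o: "Opt \<sigma>" and inj: "inj_on p {..Suc t}" and pV: "p ` {..Suc t} \<subseteq> V"
        and path: "\<And>i. i \<le> t \<Longrightarrow> p (Suc i) \<in> N (p i) \<and> \<sigma> (p i) (p (Suc i)) = c"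
        and bk: "\<sigma> (p (Suc t)) (p t) = c" by blast
      define b where "b = p (Suc t)"
      define a where "a = p t"
      have b: "b \<in> V" and aV: "a \<in> V" using pV by (auto simp: b_def a_def)
      have a: "a \<in> N b" using path[of t] sym aV by (auto simp: a_def b_def)
      have "\<not> N b \<subseteq> {a}" 
        using deg[OF b] card_mono[of "{a}" "N b"] by auto
      then obtain m where m: "m \<in> N b" "m \<noteq> a" by blast
      have mV: "m \<in> V" using m b sub by auto
      define \<tau> where "\<tau> = \<sigma>(b := (\<sigma> b)(a := \<sigma> b m, m := c))"
      have mb: "\<sigma> m b = c" and ot: "Opt \<tau>"
        using step[OF o b a _ _ m] path[of t] bk unfolding \<tau>_def by (auto simp: a_def b_def)
      have bij: "bij_betw (\<sigma> m) (N m) (R m)" using o mV by (auto simp: Opt_def B_def)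
      \<comment> \<open>An earlier \<open>p i\<close> with \<open>i < t\<close> gives
        \<open>c\<close> to \<open>p (Suc i)\<close>, whereas \<open>m\<close> gives
        \<open>c\<close> to \<open>b\<close>; each vertex gives \<open>c\<close> to only one
        neighbor.\<close>
      have new: "m \<noteq> p i" if i: "i \<le> Suc t" for i
      proof
        assume eq: "m = p i"
        have "i \<noteq> Suc t" using eq m b irr by (auto simp: b_def)
        moreover have "i \<noteq> t" using eq m by (auto simp: a_def)
        ultimately have it: "i < t" using i by simp
        have "p (Suc i) = p (Suc t)"
          using path[of i] mb bij eq it sym[OF b m(1)]
          by (metis b_def bij_betw_imp_inj_on inj_onD less_imp_le)
        then show False using inj it by (auto dest!: inj_onD)
      qed
      define q where "q = p(Suc (Suc t) := m)"
      have q1: "q i = p i" if "i \<le> Suc t" for i using that by (auto simp: q_def)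
      have q2: "q (Suc (Suc t)) = m" by (simp add: q_def)
      have at: "{..Suc (Suc t)} = insert (Suc (Suc t)) {..Suc t}" by auto
      have im_q: "q ` {..Suc t} = p ` {..Suc t}" by (rule image_cong) (use q1 in auto)
      have inj_q: "inj_on q {..Suc t}" using inj q1 by (simp add: inj_on_def)
      have "inj_on q {..Suc (Suc t)}" "q ` {..Suc (Suc t)} \<subseteq> V"
        unfolding at using inj_q im_q new pV mV q2 by (auto simp del: atMost_Suc)
      moreover have "q (Suc i) \<in> N (q i) \<and> \<tau> (q i) (q (Suc i)) = c" if "i \<le> Suc t" for i
      proof (cases "i = Suc t")
        case True
        then show ?thesis using m q1 q2 by (simp add: b_def \<tau>_def)
      next
        case False
        then have "i \<le> t" using that by simp
        moreover have "p i \<noteq> b" using inj \<open>i \<le> t\<close> unfolding b_def by (auto dest!: inj_onD)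
        ultimately show ?thesis using path[of i] q1 by (simp add: \<tau>_def)
      qed
      moreover have "\<tau> (q (Suc (Suc t))) (q (Suc t)) = c"
        using q1 q2 mb m b irr by (auto simp: \<tau>_def b_def)
      ultimately show ?case using ot by blast
    qed
    from this[of "card V"] obtain p where "inj_on p {..Suc (card V)}" "p ` {..Suc (card V)} \<subseteq> V"
      by blast
    then show False using card_inj_on_le[OF _ _ fin] by fastforce
  qed
  then show ?thesis using \<sigma> by (auto simp: Opt_def B_def K_def)
qed

section \<open>Labels from a maximum matching\<close>

text \<open>Removing an orbit {a, \<open>\<mu> a\<close>} leaves a smaller instance. The lemma will
  show that the matched vertices are even in number.\<close>

lemma even_card_involution:
  assumes "finite W" "\<And>v. v \<in> W \<Longrightarrow> \<mu> v \<in> W \<and> \<mu> (\<mu> v) = v \<and> \<mu> v \<noteq> v"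
  shows "even (card W)"
  using assms
proof (induction "card W" arbitrary: W rule: less_induct)
  case less
  show ?case
  proof (cases "W = {}")
    case False
    then obtain a where a: "a \<in> W" by blast
    let ?W = "W - {a, \<mu> a}"
    have c: "card ?W + 2 = card W"
      using less.prems(1) less.prems(2)[OF a] a card_mono[of W "{a, \<mu> a}"]
      by (subst card_Diff_subset) (auto simp: card_insert_if)
    have "\<mu> v \<in> ?W \<and> \<mu> (\<mu> v) = v \<and> \<mu> v \<noteq> v" if "v \<in> ?W" for v
      using less.prems(2)[of v] less.prems(2)[OF a] that by (metis Diff_iff insertCI insertE singletonD)
    then have "even (card ?W)"
      using less.hyps[of ?W] less.prems(1) c by simp
    then show ?thesis using c by presburger
  qed auto
qed

text \<open>A list of columns \<open>(x\<^sub>0, y\<^sub>0), (x\<^sub>1, y\<^sub>1), \<dots>\<close>: if \<open>x\<^sub>i\<close> gets the label \<open>i\<close> and \<open>y\<^sub>i\<close>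
  the label \<open>i + n/2\<close>, then both may be colored \<open>2i\<close> when they are adjacent, and \<open>y\<^sub>i\<close> may be
  colored \<open>2i + 1\<close>, the sum of the labels of \<open>y\<^sub>i\<close> and \<open>y\<^sub>i\<^sub>+\<^sub>1\<close>, when those are adjacent.\<close>

definition column_list :: "('a \<Rightarrow> 'a set) \<Rightarrow> ('a \<times> 'a) list \<Rightarrow> bool" where
  "column_list N cs \<longleftrightarrow> distinct (map fst cs @ map snd cs) \<and>
     (\<forall>i<length cs. snd (cs ! i) \<in> N (fst (cs ! i)) \<or>
        Suc i < length cs \<and> snd (cs ! Suc i) \<in> N (snd (cs ! i)))"

lemma column_list_Cons:
  assumes "column_list N cs" "x \<noteq> y" "x \<notin> fst ` set cs \<union> snd ` set cs"
    "y \<notin> fst ` set cs \<union> snd ` set cs"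
    "y \<in> N x \<or> cs \<noteq> [] \<and> snd (hd cs) \<in> N y"
  shows "column_list N ((x, y) # cs)"
proof -
  have "distinct (map fst ((x, y) # cs) @ map snd ((x, y) # cs))"
    using assms(1-4) by (auto simp: column_list_def)
  moreover have "snd (((x, y) # cs) ! i) \<in> N (fst (((x, y) # cs) ! i)) \<or>
        Suc i < length ((x, y) # cs) \<and> snd (((x, y) # cs) ! Suc i) \<in> N (snd (((x, y) # cs) ! i))"
    if "i < length ((x, y) # cs)" for i
  proof (cases i)
    case 0
    then show ?thesis using assms(5) by (auto simp: hd_conv_nth)
  next
    case (Suc j)
    then show ?thesis using assms(1) that by (simp add: column_list_def)
  qed
  ultimately show ?thesis unfolding column_list_def by blast
qed

text \<open>The fixed points of \<open>\<mu>\<close> are the unmatched vertices, split into equal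
  halves \<open>X\<close> and \<open>Y\<close>. A matching edge forms a column by itself. Unmatched
  \<open>x\<close> in \<open>X\<close> and \<open>u\<close> in \<open>Y\<close> form a column
  \<open>(x, u)\<close>, followed by the column \<open>(\<mu> b, b)\<close> with
  \<open>b = g u\<close>, so that the second components \<open>u\<close> and \<open>b\<close> are
  adjacent. The last hypothesis lets different \<open>u\<close> use different matching edges. Such
  double columns are put in front of the list, which yields the last conclusion.\<close>

lemma column_list_of_matching:
  assumes "finite W"
    and "\<And>v. v \<in> W \<Longrightarrow> \<mu> v \<in> W \<and> \<mu> (\<mu> v) = v \<and> (\<mu> v = v \<or> \<mu> v \<in> N v)"
    and "X \<union> Y = {v \<in> W. \<mu> v = v}" "X \<inter> Y = {}" "card X = card Y"
    and "\<And>u. u \<in> Y \<Longrightarrow> g u \<in> W \<and> \<mu> (g u) \<noteq> g u \<and> g u \<in> N u"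
    and "\<And>u u'. u \<in> Y \<Longrightarrow> u' \<in> Y \<Longrightarrow> u \<noteq> u' \<Longrightarrow> g u' \<noteq> g u \<and> g u' \<noteq> \<mu> (g u)"
  shows "\<exists>cs. column_list N cs \<and> fst ` set cs \<union> snd ` set cs = W \<and>
    (Y \<noteq> {} \<longrightarrow> 1 < length cs \<and> snd (cs ! 1) \<in> N (snd (cs ! 0)))"
  using assms
proof (induction "card W" arbitrary: W X Y rule: less_induct)
  case less
  note inv = less.prems(2) and XY = less.prems(3-5) and g = less.prems(6,7)
  have "finite (X \<union> Y)" using XY(1) less.prems(1) by simp
  then have fX: "finite X" "finite Y" by auto
  show ?case
  proof (cases "Y = {}")
    case True
    then have X: "X = {}" using XY fX by auto
    show ?thesis
    proof (cases "W = {}")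
      case True
      then show ?thesis using \<open>Y = {}\<close> by (intro exI[of _ "[]"]) (auto simp: column_list_def)
    next
      case False
      then obtain a where a: "a \<in> W" by blast
      have na: "\<mu> a \<noteq> a" using X True a XY \<open>Y = {}\<close> by blast
      have "\<exists>cs. column_list N cs \<and> fst ` set cs \<union> snd ` set cs = W - {a, \<mu> a} \<and>
        ({} \<noteq> ({} :: 'a set) \<longrightarrow> 1 < length cs \<and> snd (cs ! 1) \<in> N (snd (cs ! 0)))"
      proof (rule less.hyps[of _ "{}" "{}"])
        show "card (W - {a, \<mu> a}) < card W"
          using a less.prems(1) by (intro psubset_card_mono) auto
        show "\<mu> v \<in> W - {a, \<mu> a} \<and> \<mu> (\<mu> v) = v \<and> (\<mu> v = v \<or> \<mu> v \<in> N v)" if "v \<in> W - {a, \<mu> a}" for v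
          using inv[of v] inv[OF a] that by (metis Diff_iff insertCI insertE singletonD)
        show "{} \<union> {} = {v \<in> W - {a, \<mu> a}. \<mu> v = v}" using X XY \<open>Y = {}\<close> by auto
      qed (use less.prems(1) in auto)
      then obtain cs where "column_list N cs" "fst ` set cs \<union> snd ` set cs = W - {a, \<mu> a}" by blast
      then have "column_list N ((a, \<mu> a) # cs)" "fst ` set ((a, \<mu> a) # cs) \<union> snd ` set ((a, \<mu> a) # cs) = W"
        using na a inv[of a] by (auto intro!: column_list_Cons)
      then show ?thesis using \<open>Y = {}\<close> by blast
    qed
  next
    case False
    then obtain u where u: "u \<in> Y" by blast
    then have "X \<noteq> {}" using XY fX by auto
    then obtain x where x: "x \<in> X" by blast
    define b where "b = g u"
    have b: "b \<in> W" "\<mu> b \<noteq> b" "b \<in> N u" using g u by (auto simp: b_def)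
    have mb: "\<mu> b \<in> W" "\<mu> (\<mu> b) = b" "\<mu> b \<in> N b" using inv[of b] b by auto
    have fx: "x \<in> W" "\<mu> x = x" "u \<in> W" "\<mu> u = u" "x \<noteq> u" using u x XY by blast+
    have d: "b \<noteq> x" "b \<noteq> u" "\<mu> b \<noteq> x" "\<mu> b \<noteq> u" using b mb fx by metis+
    let ?D = "{x, u, b, \<mu> b}"
    have "\<exists>cs. column_list N cs \<and> fst ` set cs \<union> snd ` set cs = W - ?D \<and>
        (Y - {u} \<noteq> {} \<longrightarrow> 1 < length cs \<and> snd (cs ! 1) \<in> N (snd (cs ! 0)))"
    proof (rule less.hyps[of _ "X - {x}" "Y - {u}"])
      show "card (W - ?D) < card W"
        using b less.prems(1) by (intro psubset_card_mono) auto
      show "\<mu> v \<in> W - ?D \<and> \<mu> (\<mu> v) = v \<and> (\<mu> v = v \<or> \<mu> v \<in> N v)" if "v \<in> W - ?D" for v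
        using inv[of v] that mb fx by (metis Diff_iff insertCI insertE singletonD)
      have "X - {x} \<union> (Y - {u}) = (X \<union> Y) - {x, u}" using XY(2) u x by blast
      also have "\<dots> = {v \<in> W - ?D. \<mu> v = v}"
        unfolding XY(1) using b(2) mb(2) by (intro equalityI subsetI; force)
      finally show "X - {x} \<union> (Y - {u}) = {v \<in> W - ?D. \<mu> v = v}" .
      show "(X - {x}) \<inter> (Y - {u}) = {}" using XY by auto
      show "card (X - {x}) = card (Y - {u})" using XY u x by simp
      \<comment> \<open>\<open>g v\<close> avoids \<open>x\<close> and \<open>u\<close> because
        \<open>\<mu>\<close> moves it, and \<open>b\<close> and \<open>\<mu> b\<close> because the
        matching edges chosen for \<open>u\<close> and \<open>v\<close> differ.\<close>
      show "g v \<in> W - ?D \<and> \<mu> (g v) \<noteq> g v \<and> g v \<in> N v" if "v \<in> Y - {u}" for v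
        using g(1)[of v] g(2)[OF u, of v] that fx by (auto simp: b_def)
      show "g u' \<noteq> g v \<and> g u' \<noteq> \<mu> (g v)" if "v \<in> Y - {u}" "u' \<in> Y - {u}" "v \<noteq> u'" for v u'
        using g(2) that by blast
    qed (use less.prems(1) in auto)
    then obtain cs where cs: "column_list N cs" "fst ` set cs \<union> snd ` set cs = W - ?D" by blast
    let ?cs = "(\<mu> b, b) # cs"
    have bu: "b \<in> N (\<mu> b)" using inv[OF mb(1)] mb(2) b(2) by metis
    have 1: "column_list N ?cs"
      by (rule column_list_Cons[OF cs(1) b(2)]) (use bu in \<open>simp_all add: cs(2)\<close>)
    have D: "fst ` set ?cs \<union> snd ` set ?cs = (W - ?D) \<union> {b, \<mu> b}" using cs(2) by auto
    have 2: "column_list N ((x, u) # ?cs)"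
    proof (rule column_list_Cons[OF 1 fx(5)])
      show "x \<notin> fst ` set ?cs \<union> snd ` set ?cs" "u \<notin> fst ` set ?cs \<union> snd ` set ?cs"
        unfolding D using d by auto
    qed (use b(3) in simp)
    have "fst ` set ((x, u) # ?cs) \<union> snd ` set ((x, u) # ?cs) = W"
      using D b(1) mb(1) fx(1,3) by auto
    with 2 b(3) show ?thesis by (intro exI[of _ "(x, u) # ?cs"]) simp
  qed
qed


text \<open>In a maximum matching \<open>\<mu>\<close> (an involution with as few fixed points as possible) no two edges
  at distinct unmatched vertices lead to the same matching edge. By double counting, a maximal
  injective choice of such edges covers at least half of the unmatched vertices.\<close>

lemma exists_column_list:
  fixes N :: "'a \<Rightarrow> 'a set"
  assumes fin: "finite V" and V0: "V \<noteq> {}" and sub: "\<And>v. v \<in> V \<Longrightarrow> N v \<subseteq> V"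
    and sym: "\<And>v w. v \<in> V \<Longrightarrow> w \<in> N v \<Longrightarrow> v \<in> N w"
    and irr: "\<And>v. v \<in> V \<Longrightarrow> v \<notin> N v"
    and deg: "\<And>v. v \<in> V \<Longrightarrow> card (N v) = k" and k: "2 \<le> k" and ev: "even (card V)"
  shows "\<exists>cs. column_list N cs \<and> fst ` set cs \<union> snd ` set cs = V \<and>
    1 < length cs \<and> snd (cs ! 1) \<in> N (snd (cs ! 0))"
proof -
  define M where "M \<mu> \<longleftrightarrow> (\<forall>v\<in>V. \<mu> v \<in> V \<and> \<mu> (\<mu> v) = v \<and> (\<mu> v = v \<or> \<mu> v \<in> N v))" for \<mu>
  define F where "F \<mu> = {v \<in> V. \<mu> v = v}" for \<mu>
  have finF: "finite (F \<mu>)" for \<mu> using fin by (simp add: F_def)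
  have finN: "finite (N v)" if "v \<in> V" for v using sub[OF that] fin finite_subset by blast
  have "M id" by (simp add: M_def)
  then obtain \<mu> where M: "M \<mu>" and min: "\<And>\<nu>. M \<nu> \<Longrightarrow> card (F \<mu>) \<le> card (F \<nu>)"
    using ex_has_least_nat[of M id "\<lambda>\<mu>. card (F \<mu>)"] by blast
  have no_better: "\<not> F \<nu> \<subset> F \<mu>" if "M \<nu>" for \<nu>
    using min[OF that] psubset_card_mono[OF finF] by (metis not_le)
  have MV: "\<mu> v \<in> V" and MM: "\<mu> (\<mu> v) = v" and MN: "\<mu> v = v \<or> \<mu> v \<in> N v" if "v \<in> V" for v
    using M that by (auto simp: M_def)
  show ?thesis
  proof (cases "F \<mu> = {}")
    case True
    \<comment> \<open>The matching is perfect, but the first two columns must still have adjacent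
      second components. So one matching edge {x, u} is given up, and \<open>u\<close> uses a
      neighbor \<open>b\<close> other than \<open>x\<close>, which exists because
      \<open>k \<ge> 2\<close>.\<close>
    obtain x where x: "x \<in> V" using V0 by blast
    define u where "u = \<mu> x"
    have xu: "x \<noteq> u" "u \<in> V" "\<mu> u = x" using x True MV MM by (auto simp: F_def u_def)
    have "\<not> N u \<subseteq> {x}" using deg[of u] xu k card_mono[of "{x}" "N u"] by auto
    then obtain b where b: "b \<in> N u" "b \<noteq> x" by blast
    have bV: "b \<in> V" "b \<noteq> u" using b xu sub irr by auto
    define \<nu> where "\<nu> = \<mu>(x := x, u := u)"
    have off: "\<mu> v \<noteq> x \<and> \<mu> v \<noteq> u" if "v \<in> V" "v \<noteq> x" "v \<noteq> u" for v
      using that MM xu u_def by metis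
    have "\<mu> b \<noteq> b" using True bV by (auto simp: F_def)
    have "\<exists>cs. column_list N cs \<and> fst ` set cs \<union> snd ` set cs = V \<and>
      ({u} \<noteq> {} \<longrightarrow> 1 < length cs \<and> snd (cs ! 1) \<in> N (snd (cs ! 0)))"
    proof (rule column_list_of_matching[of V \<nu> N "{x}" "{u}" "\<lambda>_. b"])
      show "\<nu> v \<in> V \<and> \<nu> (\<nu> v) = v \<and> (\<nu> v = v \<or> \<nu> v \<in> N v)" if "v \<in> V" for v
        using off[OF that] MV[OF that] MM[OF that] MN[OF that] that by (auto simp: \<nu>_def)
      show "{x} \<union> {u} = {v \<in> V. \<nu> v = v}"
        using True x xu by (auto simp: \<nu>_def F_def)
      show "b \<in> V \<and> \<nu> b \<noteq> b \<and> b \<in> N v" if "v \<in> {u}" for v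
        using that b bV \<open>\<mu> b \<noteq> b\<close> by (simp add: \<nu>_def)
    qed (use fin xu in auto)
    then show ?thesis by simp
  next
    case False
    let ?U = "F \<mu>"
    \<comment> \<open>Two adjacent unmatched vertices could be matched to each other.\<close>
    have indep: "u' \<notin> N u" if u: "u \<in> ?U" "u' \<in> ?U" for u u'
    proof
      assume a: "u' \<in> N u"
      define \<nu> where "\<nu> = \<mu>(u := u', u' := u)"
      have V: "u \<in> V" "u' \<in> V" "\<mu> u = u" "\<mu> u' = u'" using u by (auto simp: F_def)
      have ne: "u \<noteq> u'" using a irr V by auto
      have off: "\<mu> v \<noteq> u \<and> \<mu> v \<noteq> u'" if "v \<in> V" "v \<noteq> u" "v \<noteq> u'" for v
        using that MM V by metis
      have "\<nu> v \<in> V \<and> \<nu> (\<nu> v) = v \<and> (\<nu> v = v \<or> \<nu> v \<in> N v)" if "v \<in> V" for v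
        using off[OF that] MV[OF that] MM[OF that] MN[OF that] that a sym[OF V(1) a] V ne
        by (auto simp: \<nu>_def)
      then have "M \<nu>" by (simp add: M_def)
      moreover have "F \<nu> \<subseteq> F \<mu>" using ne by (auto simp: F_def \<nu>_def split: if_splits)
      moreover have "u \<notin> F \<nu>" using ne by (simp add: F_def \<nu>_def)
      ultimately show False using no_better u(1) by blast
    qed
    \<comment> \<open>Otherwise \<open>u\<close>, \<open>a\<close>, \<open>a'\<close>,
      \<open>u'\<close> is an augmenting path: matching \<open>u\<close> with \<open>a\<close> and
      \<open>u'\<close> with \<open>a'\<close> leaves fewer fixed points.\<close>
    have no_aug: "a' \<noteq> \<mu> a"
      if u: "u \<in> ?U" "u' \<in> ?U" "u \<noteq> u'" and a: "a \<in> N u" "a' \<in> N u'" and d: "a \<noteq> a'" for u u' a a'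
    proof -
      have V: "u \<in> V" "u' \<in> V" "\<mu> u = u" "\<mu> u' = u'" using u by (auto simp: F_def)
      have aV: "a \<in> V" "a' \<in> V" using a V sub by auto
      have aU: "\<mu> a \<noteq> a" "\<mu> a' \<noteq> a'" using indep[OF u(1), of a] indep[OF u(2), of a'] a aV by (auto simp: F_def)
      show ?thesis
      proof
        assume eq: "a' = \<mu> a"
        have eq': "\<mu> a' = a" using eq MM aV by simp
        have ne: "a \<noteq> u" "a \<noteq> u'" "a' \<noteq> u" "a' \<noteq> u'" using V aU by auto
        define \<nu> where "\<nu> = \<mu>(u := a, a := u, u' := a', a' := u')"
        have off: "\<mu> v \<noteq> u \<and> \<mu> v \<noteq> u' \<and> \<mu> v \<noteq> a \<and> \<mu> v \<noteq> a'"
          if "v \<in> V" "v \<noteq> u" "v \<noteq> u'" "v \<noteq> a" "v \<noteq> a'" for v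
          using that MM V eq eq' by metis
        have "\<nu> v \<in> V \<and> \<nu> (\<nu> v) = v \<and> (\<nu> v = v \<or> \<nu> v \<in> N v)" if "v \<in> V" for v
        proof (cases "v \<in> {u, u', a, a'}")
          case True
          then show ?thesis
            using V aV a sym[OF V(1) a(1)] sym[OF V(2) a(2)] ne d u(3) by (auto simp: \<nu>_def)
        next
          case False
          then have "\<nu> v = \<mu> v" "\<nu> (\<mu> v) = \<mu> (\<mu> v)" using off[OF that] by (auto simp: \<nu>_def)
          then show ?thesis using MV[OF that] MM[OF that] MN[OF that] by simp
        qed
        then have "M \<nu>" by (simp add: M_def)
        moreover have "F \<nu> \<subseteq> F \<mu>" using ne by (auto simp: F_def \<nu>_def split: if_splits)
        moreover have "u \<notin> F \<nu>" using ne u(3) by (simp add: F_def \<nu>_def)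
        ultimately show False using no_better u(1) by blast
      qed
    qed
    \<comment> \<open>Only half of \<open>?U\<close> has to be served by distinct neighbors, so a
      maximal \<open>X\<close> and a rough count can replace Hall's theorem.\<close>
    define P where "P X \<longleftrightarrow> X \<subseteq> ?U \<and> (\<exists>g. inj_on g X \<and> (\<forall>u\<in>X. g u \<in> N u))" for X
    have "P {}" by (simp add: P_def)
    moreover have "{X. P X} \<subseteq> Pow ?U" by (auto simp: P_def)
    then have "finite {X. P X}" using finF finite_subset by blast
    ultimately obtain X where PX: "P X" and maxX: "\<And>Z. P Z \<Longrightarrow> X \<subseteq> Z \<Longrightarrow> X = Z"
      using finite_has_maximal[of "{X. P X}"] by auto
    then obtain g where XU: "X \<subseteq> ?U" and g: "inj_on g X" "\<And>u. u \<in> X \<Longrightarrow> g u \<in> N u"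
      by (auto simp: P_def)
    have finX: "finite X" using XU finF finite_subset by blast
    have UV: "?U \<subseteq> V" by (auto simp: F_def)
    have cover: "N u \<subseteq> g ` X" if u: "u \<in> ?U - X" for u
    proof (rule ccontr)
      assume "\<not> N u \<subseteq> g ` X"
      then obtain b where b: "b \<in> N u" "b \<notin> g ` X" by blast
      have "P (insert u X)" unfolding P_def
      proof (intro conjI exI[of _ "g(u := b)"])
        show "inj_on (g(u := b)) (insert u X)"
          using g(1) b(2) u by (auto simp: inj_on_def)
      qed (use XU u g b in auto)
      then show False using maxX[of "insert u X"] u by auto
    qed
    \<comment> \<open>By \<open>cover\<close>, all \<open>k * card (?U - X)\<close> edges at
      \<open>?U - X\<close> end in the image of \<open>X\<close> under \<open>g\<close>, whose
      vertices have at most \<open>k * card X\<close> edges in total.\<close>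
    have half: "card (?U - X) \<le> card X"
    proof -
      have gX: "g ` X \<subseteq> V" using g(2) sub UV XU by blast
      have finS: "finite (Sigma (g ` X) N)"
        by (rule finite_SigmaI) (use finX finN gX in auto)
      have "k * card (?U - X) = (\<Sum>u\<in>?U - X. card (N u))" using deg UV by (simp add: subset_iff)
      also have "\<dots> = card (Sigma (?U - X) N)"
        using finF finN UV by (subst card_SigmaI) auto
      also have "\<dots> \<le> card (prod.swap ` Sigma (g ` X) N)"
      proof (rule card_mono)
        show "finite (prod.swap ` Sigma (g ` X) N)" using finS by simp
        show "Sigma (?U - X) N \<subseteq> prod.swap ` Sigma (g ` X) N"
          using cover UV sym by (auto simp: image_iff) blast+
      qed
      also have "\<dots> \<le> card (Sigma (g ` X) N)"
        by (rule card_image_le[OF finS])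
      also have "\<dots> = (\<Sum>w\<in>g ` X. card (N w))"
        using finX finN gX by (subst card_SigmaI) auto
      also have "\<dots> = k * card X"
        using deg gX g(1) by (simp add: subset_iff card_image)
      finally show ?thesis using k by simp
    qed
    have cU: "card ?U = card X + card (?U - X)"
      using XU finF card_mono[OF finF XU] by (simp add: card_Diff_subset finX)
    \<comment> \<open>Matched vertices come in pairs, so \<open>?U\<close> has even size. Half of it
      fits into \<open>X\<close> and becomes \<open>Y\<close>; all other unmatched vertices form the
      opposite half.\<close>
    have "even (card (V - ?U))"
    proof (rule even_card_involution[of _ \<mu>])
      show "\<mu> v \<in> V - ?U \<and> \<mu> (\<mu> v) = v \<and> \<mu> v \<noteq> v" if "v \<in> V - ?U" for v
        using that MV MM by (auto simp: F_def)
    qed (use fin in simp)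
    then have "even (card ?U)"
      using ev card_Diff_subset[OF finF UV] card_mono[OF fin UV] by auto
    then obtain r where r: "card ?U = 2 * r" by blast
    have "r \<le> card X" using half cU r by simp
    then obtain Y where Y: "Y \<subseteq> X" "card Y = r" by (meson obtain_subset_with_card_n)
    have r0: "r \<noteq> 0" using r False finF by auto
    have "\<exists>cs. column_list N cs \<and> fst ` set cs \<union> snd ` set cs = V \<and>
      (Y \<noteq> {} \<longrightarrow> 1 < length cs \<and> snd (cs ! 1) \<in> N (snd (cs ! 0)))"
    proof (rule column_list_of_matching[of V \<mu> N "?U - Y" Y g])
      show "\<mu> v \<in> V \<and> \<mu> (\<mu> v) = v \<and> (\<mu> v = v \<or> \<mu> v \<in> N v)" if "v \<in> V" for v
        using that MV MM MN by blast
      show "?U - Y \<union> Y = {v \<in> V. \<mu> v = v}" using Y XU by (auto simp: F_def)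
      show "card (?U - Y) = card Y"
        using Y XU finX finite_subset r by (subst card_Diff_subset) auto
      show "g u \<in> V \<and> \<mu> (g u) \<noteq> g u \<and> g u \<in> N u" if "u \<in> Y" for u
      proof -
        have u: "u \<in> ?U" "u \<in> V" "g u \<in> N u" using that Y XU UV g by auto
        then have "g u \<in> V" using sub by blast
        moreover have "g u \<notin> ?U" using indep[OF u(1)] u(3) by blast
        ultimately show ?thesis using u by (auto simp: F_def)
      qed
      show "g u' \<noteq> g u \<and> g u' \<noteq> \<mu> (g u)" if "u \<in> Y" "u' \<in> Y" "u \<noteq> u'" for u u'
      proof -
        have "g u \<noteq> g u'" using g(1) Y that by (auto dest: inj_onD)
        then show ?thesis using no_aug[of u u' "g u" "g u'"] that Y XU g by auto
      qed
    qed (use fin in auto)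
    moreover have "Y \<noteq> {}" using Y r0 by auto
    ultimately show ?thesis by simp
  qed
qed


section \<open>The central graph\<close>

definition nbrs :: "'a graph \<Rightarrow> 'a \<Rightarrow> 'a set" where
  "nbrs G v = {w. {v, w} \<in> edges G}"

lemma nbrs_sym: "w \<in> nbrs G v \<longleftrightarrow> v \<in> nbrs G w"
  by (simp add: nbrs_def insert_commute)

lemma nbrs_subset: "finite_simple_graph G \<Longrightarrow> nbrs G v \<subseteq> vertices G"
  by (auto simp: nbrs_def finite_simple_graph_def)

lemma nbrs_irrefl: "finite_simple_graph G \<Longrightarrow> v \<notin> nbrs G v"
  by (auto simp: nbrs_def finite_simple_graph_def)

lemma edge_cases:
  assumes "finite_simple_graph G" "e \<in> edges G"
  obtains u v where "e = {u, v}" "u \<noteq> v" "v \<in> nbrs G u" "u \<in> vertices G" "v \<in> vertices G"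
proof -
  have "card e = 2" "e \<subseteq> vertices G" using assms by (auto simp: finite_simple_graph_def)
  then obtain u v where "e = {u, v}" "u \<noteq> v" by (auto simp: card_2_iff)
  then show thesis using that[of u v] assms(2) \<open>e \<subseteq> vertices G\<close> by (auto simp: nbrs_def)
qed

lemma card_nbrs:
  assumes "finite_simple_graph G"
  shows "card (nbrs G v) = vertex_degree G v"
proof -
  have "{e \<in> edges G. v \<in> e} = (\<lambda>w. {v, w}) ` nbrs G v"
  proof (intro equalityI subsetI)
    fix e assume "e \<in> {e \<in> edges G. v \<in> e}"
    then have e: "e \<in> edges G" "v \<in> e" by auto
    obtain a b where "e = {a, b}" using edge_cases[OF assms e(1)] by metis
    then have "e = {v, a} \<or> e = {v, b}" using e(2) by auto
    then show "e \<in> (\<lambda>w. {v, w}) ` nbrs G v" using e(1) by (auto simp: nbrs_def)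
  qed (auto simp: nbrs_def)
  moreover have "inj_on (\<lambda>w. {v, w}) (nbrs G v)" by (auto simp: inj_on_def doubleton_eq_iff)
  ultimately show ?thesis by (simp add: vertex_degree_def card_image)
qed

lemma connected_induct:
  assumes "connected_graph G" "u \<in> vertices G" "v \<in> vertices G" "P u"
    and "\<And>x y. P x \<Longrightarrow> y \<in> nbrs G x \<Longrightarrow> P y"
  shows "P v"
proof -
  have "(u, v) \<in> {(x, y). {x, y} \<in> edges G}\<^sup>*" using assms by (auto simp: connected_graph_def)
  then show ?thesis using \<open>P u\<close>
    by (induction rule: rtrancl_induct) (use assms(5) in \<open>auto simp: nbrs_def\<close>)
qed

text \<open>For \<open>k \<le> 1\<close> a neighbor of \<open>u\<close> has no neighbor except
  \<open>u\<close>. So \<open>u\<close> and its neighbors are closed under adjacency and by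
  connectedness exhaust the graph, which then has at most two vertices.\<close>

lemma connected_regular_degree_ge_2:
  assumes G: "finite_simple_graph G" "connected_graph G" "2 < card (vertices G)"
    and deg: "\<And>v. v \<in> vertices G \<Longrightarrow> card (nbrs G v) = k"
  shows "2 \<le> k"
proof (rule ccontr)
  assume "\<not> 2 \<le> k"
  have finV: "finite (vertices G)" using G by (simp add: finite_simple_graph_def)
  obtain u where u: "u \<in> vertices G" using G(3) by fastforce
  have fin: "finite (nbrs G v)" for v using nbrs_subset[OF G(1)] finV finite_subset by blast
  have "v \<in> insert u (nbrs G u)" if "v \<in> vertices G" for v
  proof (rule connected_induct[OF G(2) u that])
    fix x y assume x: "x \<in> insert u (nbrs G u)" and y: "y \<in> nbrs G x"
    show "y \<in> insert u (nbrs G u)"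
    proof (cases "x = u")
      case False
      then have xu: "x \<in> nbrs G u" "u \<in> nbrs G x" using x nbrs_sym by fastforce+
      have "x \<in> vertices G" using xu nbrs_subset[OF G(1)] by blast
      then have "card (nbrs G x) \<le> 1" using deg[of x] \<open>\<not> 2 \<le> k\<close> by simp
      then have "y = u" using xu y fin by (simp add: card_le_Suc0_iff_eq)
      then show ?thesis by simp
    qed (use y in simp)
  qed simp
  then have "card (vertices G) \<le> card (insert u (nbrs G u))"
    by (intro card_mono) (use fin in auto)
  also have "\<dots> \<le> Suc (card (nbrs G u))" by (rule card_insert_le_m1) auto
  finally show False using deg[OF u] G(3) \<open>\<not> 2 \<le> k\<close> by simp
qed

section \<open>Edges and degrees of the central graph\<close>

text \<open>Each vertex \<open>w\<close> of \<open>G\<close> other than \<open>v\<close> accounts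
  for exactly one neighbor of \<open>Orig v\<close>, so the edges at \<open>Orig v\<close> are
  indexed by the other vertices of \<open>G\<close>. All edges have the form
  \<open>central_edge G v w\<close>: the two orders of a nonadjacent pair give the same edge, those
  of an adjacent pair give the two halves of a subdivided edge.\<close>

definition central_nbr :: "'a graph \<Rightarrow> 'a \<Rightarrow> 'a \<Rightarrow> 'a central_vertex" where
  "central_nbr G v w = (if w \<in> nbrs G v then Subdiv {v, w} else Orig w)"

definition central_edge :: "'a graph \<Rightarrow> 'a \<Rightarrow> 'a \<Rightarrow> 'a central_vertex set" where
  "central_edge G v w = {Orig v, central_nbr G v w}"

lemma central_nbr_inj: "inj_on (central_nbr G v) A"
  by (auto simp: inj_on_def central_nbr_def doubleton_eq_iff split: if_splits)

lemma central_edge_inj: "inj_on (central_edge G v) (A - {v})"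
  by (auto simp: inj_on_def central_edge_def central_nbr_def doubleton_eq_iff split: if_splits)

lemma Orig_in_vertices [simp]: "Orig v \<in> vertices (central_graph G) \<longleftrightarrow> v \<in> vertices G"
  and Subdiv_in_vertices [simp]: "Subdiv e \<in> vertices (central_graph G) \<longleftrightarrow> e \<in> edges G"
  by (auto simp: central_graph_def)

lemma edges_central_graph:
  assumes "finite_simple_graph G"
  shows "edges (central_graph G) = (\<Union>v\<in>vertices G. central_edge G v ` (vertices G - {v}))"
proof (intro equalityI subsetI)
  fix X assume "X \<in> edges (central_graph G)"
  then consider u v where "X = {Orig u, Orig v}" "u \<in> vertices G" "v \<in> vertices G" "u \<noteq> v" "v \<notin> nbrs G u"
    | u e where "X = {Orig u, Subdiv e}" "e \<in> edges G" "u \<in> e"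
    by (auto simp: central_graph_def nbrs_def)
  then show "X \<in> (\<Union>v\<in>vertices G. central_edge G v ` (vertices G - {v}))"
  proof cases
    case 1
    then have "X = central_edge G u v" by (simp add: central_edge_def central_nbr_def)
    with 1 show ?thesis by blast
  next
    case 2
    obtain a b where ab: "e = {a, b}" "a \<noteq> b" "b \<in> nbrs G a" "a \<in> vertices G" "b \<in> vertices G"
      using edge_cases[OF assms 2(2)] .
    have "central_edge G a b = {Orig a, Subdiv e}" "central_edge G b a = {Orig b, Subdiv e}"
      using ab nbrs_sym[of a G b] by (auto simp: central_edge_def central_nbr_def insert_commute)
    then have "X = central_edge G a b \<or> X = central_edge G b a" using 2 ab by auto
    with ab show ?thesis by blast
  qed
next
  fix X assume "X \<in> (\<Union>v\<in>vertices G. central_edge G v ` (vertices G - {v}))"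
  then obtain v w where vw: "X = central_edge G v w" "v \<in> vertices G" "w \<in> vertices G" "w \<noteq> v"
    by blast
  show "X \<in> edges (central_graph G)"
  proof (cases "w \<in> nbrs G v")
    case True
    then have "\<exists>u e. X = {Orig u, Subdiv e} \<and> e \<in> edges G \<and> u \<in> e"
      using vw(1) by (intro exI[of _ v] exI[of _ "{v, w}"]) (simp add: central_edge_def central_nbr_def nbrs_def)
    then show ?thesis by (simp add: central_graph_def)
  next
    case False
    then have "\<exists>u w. X = {Orig u, Orig w} \<and> u \<in> vertices G \<and> w \<in> vertices G \<and> u \<noteq> w \<and> {u, w} \<notin> edges G"
      using vw by (intro exI[of _ v] exI[of _ w]) (simp add: central_edge_def central_nbr_def nbrs_def)
    then show ?thesis by (simp add: central_graph_def)
  qed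
qed

lemma central_edge_in_edges:
  "finite_simple_graph G \<Longrightarrow> v \<in> vertices G \<Longrightarrow> w \<in> vertices G \<Longrightarrow> w \<noteq> v \<Longrightarrow>
     central_edge G v w \<in> edges (central_graph G)"
  using edges_central_graph by fastforce

lemma central_edge_sym:
  "w \<notin> nbrs G v \<Longrightarrow> central_edge G v w = central_edge G w v"
  using nbrs_sym[of v G w] by (auto simp: central_edge_def central_nbr_def)

lemma edges_at_Orig:
  assumes "finite_simple_graph G" "v \<in> vertices G"
  shows "{X \<in> edges (central_graph G). Orig v \<in> X} = central_edge G v ` (vertices G - {v})"
proof -
  have "X \<in> central_edge G v ` (vertices G - {v})"
    if "X = central_edge G u w" "u \<in> vertices G" "w \<in> vertices G" "w \<noteq> u" "Orig v \<in> X" for X u w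
  proof (cases "u = v")
    case False
    then have "w = v" "v \<notin> nbrs G u"
      using that by (auto simp: central_edge_def central_nbr_def split: if_splits)
    then show ?thesis using that central_edge_sym[of v G u] by auto
  qed (use that in auto)
  then show ?thesis
    unfolding edges_central_graph[OF assms(1)] using assms(2) by (auto simp: central_edge_def)
qed

lemma edges_at_Subdiv:
  assumes "finite_simple_graph G" "X \<in> edges (central_graph G)" "Subdiv {u, v} \<in> X"
  shows "X = central_edge G u v \<or> X = central_edge G v u"
proof -
  obtain a b where "X = central_edge G a b" using assms(1,2) by (auto simp: edges_central_graph)
  then show ?thesis using assms(3)
    by (auto simp: central_edge_def central_nbr_def doubleton_eq_iff split: if_splits)
qed

lemma vertex_degree_Orig:
  assumes "finite_simple_graph G" "v \<in> vertices G"
  shows "vertex_degree (central_graph G) (Orig v) = card (vertices G) - 1"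
  using assms
  by (simp add: vertex_degree_def edges_at_Orig card_image central_edge_inj finite_simple_graph_def)

lemma vertex_degree_Subdiv:
  assumes "finite_simple_graph G" "e \<in> edges G"
  shows "vertex_degree (central_graph G) (Subdiv e) \<le> 2"
proof -
  obtain u v where "e = {u, v}" using edge_cases[OF assms] by metis
  then have "{X \<in> edges (central_graph G). Subdiv e \<in> X} \<subseteq> {central_edge G u v, central_edge G v u}"
    using edges_at_Subdiv[OF assms(1)] by blast
  then have "vertex_degree (central_graph G) (Subdiv e) \<le> card {central_edge G u v, central_edge G v u}"
    unfolding vertex_degree_def by (intro card_mono) auto
  also have "\<dots> \<le> 2" by (simp add: card_insert_if)
  finally show ?thesis .
qed

lemma finite_edges: "finite_simple_graph G \<Longrightarrow> finite (edges G)"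
  unfolding finite_simple_graph_def by (rule finite_subset[of _ "Pow (vertices G)"]) auto

text \<open>Original vertices have degree one less than the order, hence at least 2, and subdividing
  vertices have degree at most 2.\<close>

lemma max_degree_central_graph:
  assumes G: "finite_simple_graph G" "3 \<le> card (vertices G)"
  shows "max_degree (central_graph G) = card (vertices G) - 1"
  unfolding max_degree_def
proof (rule Max_eqI)
  have "finite (vertices (central_graph G))"
    using G finite_edges by (auto simp: central_graph_def finite_simple_graph_def)
  then show "finite (vertex_degree (central_graph G) ` vertices (central_graph G))" by simp
  obtain v where "v \<in> vertices G" using G(2) by fastforce
  then show "card (vertices G) - 1 \<in> vertex_degree (central_graph G) ` vertices (central_graph G)"
    using vertex_degree_Orig[OF G(1)] by (metis Orig_in_vertices image_eqI)
  show "d \<le> card (vertices G) - 1"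
    if d: "d \<in> vertex_degree (central_graph G) ` vertices (central_graph G)" for d
  proof -
    obtain x where x: "x \<in> vertices (central_graph G)" "d = vertex_degree (central_graph G) x"
      using d by blast
    then show ?thesis
      using vertex_degree_Orig[OF G(1)] vertex_degree_Subdiv[OF G(1)] G(2) by (cases x) fastforce+
  qed
qed

text \<open>A vertex and its incident edges have pairwise different colors.\<close>

lemma proper_total_coloring_lower_bound:
  assumes f: "proper_total_coloring H d f" and v: "v \<in> vertices H"
    and fin: "finite (edges H)"
  shows "vertex_degree H v < d"
proof -
  let ?E = "{e \<in> edges H. v \<in> e}"
  have "inj_on f (insert (Inl v) (Inr ` ?E))"
    using f v unfolding proper_total_coloring_def inj_on_def by (auto; metis disjoint_iff)
  moreover have "f ` insert (Inl v) (Inr ` ?E) \<subseteq> {..<d}"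
    using f v unfolding proper_total_coloring_def by auto
  ultimately have "card (insert (Inl v) (Inr ` ?E)) \<le> card {..<d}"
    by (meson card_inj_on_le finite_lessThan)
  moreover have "card (insert (Inl v) (Inr ` ?E)) = Suc (vertex_degree H v)"
    using fin by (subst card_insert_disjoint) (auto simp: vertex_degree_def card_image)
  ultimately show ?thesis by simp
qed


lemma central_edge_eq:
  assumes "central_edge G v w = central_edge G v' w'" "v \<noteq> w" "v' \<noteq> w'"
  shows "v = v' \<and> w = w' \<or> v = w' \<and> w = v' \<and> w \<notin> nbrs G v"
  using assms
  by (auto simp: central_edge_def central_nbr_def doubleton_eq_iff split: if_splits)

section \<open>Color-preserving automorphisms\<close>

text \<open>The image of the edge {x, y} is an edge at \<open>x\<close> of the same color, hence the
  same edge.\<close>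

lemma automorphism_fixes_nbr:
  assumes \<phi>: "automorphism H \<phi>" "preserves_coloring H \<phi> f" and f: "proper_total_coloring H d f"
    and xy: "{x, y} \<in> edges H" "x \<in> vertices H" "y \<in> vertices H" and x: "\<phi> x = x"
  shows "\<phi> y = y"
proof -
  have "{x, \<phi> y} \<in> edges H" using \<phi>(1) xy x unfolding graph_isomorphism_def by metis
  moreover have "f (Inr {x, \<phi> y}) = f (Inr {x, y})"
    using \<phi>(2) xy x unfolding preserves_coloring_def by force
  moreover have "e = e'" if "e \<in> edges H" "e' \<in> edges H" "x \<in> e" "x \<in> e'" "f (Inr e) = f (Inr e')" for e e'
    using f that unfolding proper_total_coloring_def by (metis disjoint_iff)
  ultimately have "{x, \<phi> y} = {x, y}" using xy(1) by blast
  then show ?thesis using x by (auto simp: doubleton_eq_iff)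
qed

text \<open>If \<open>Orig v\<close> were sent to \<open>Subdiv e\<close>, its at least three
  neighbors would be mapped injectively to the two ends of \<open>e\<close>.\<close>

lemma automorphism_maps_Orig_to_Orig:
  assumes G: "finite_simple_graph G" "4 \<le> card (vertices G)"
    and \<phi>: "automorphism (central_graph G) \<phi>" and v: "v \<in> vertices G"
  shows "\<phi> (Orig v) \<in> Orig ` vertices G"
proof (rule ccontr)
  let ?H = "central_graph G"
  assume no: "\<phi> (Orig v) \<notin> Orig ` vertices G"
  have bij: "bij_betw \<phi> (vertices ?H) (vertices ?H)"
    and edge: "\<And>x y. x \<in> vertices ?H \<Longrightarrow> y \<in> vertices ?H \<Longrightarrow> {x, y} \<in> edges ?H \<longleftrightarrow> {\<phi> x, \<phi> y} \<in> edges ?H"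
    using \<phi> by (auto simp: graph_isomorphism_def)
  have "\<phi> (Orig v) \<in> vertices ?H" using bij v by (auto simp: bij_betw_def)
  then obtain e where e: "\<phi> (Orig v) = Subdiv e" "e \<in> edges G"
    using no by (auto simp: central_graph_def)
  obtain a b where ab: "e = {a, b}" using edge_cases[OF G(1) e(2)] by metis
  let ?A = "central_nbr G v ` (vertices G - {v})"
  have A: "?A \<subseteq> vertices ?H" by (auto simp: central_nbr_def nbrs_def)
  have "\<phi> ` ?A \<subseteq> {Orig a, Orig b}"
  proof
    fix y assume "y \<in> \<phi> ` ?A"
    then obtain w where w: "w \<in> vertices G" "w \<noteq> v" "y = \<phi> (central_nbr G v w)" by blast
    have "{Orig v, central_nbr G v w} \<in> edges ?H"
      using central_edge_in_edges[OF G(1) v w(1,2)] by (simp add: central_edge_def)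
    then have "{Subdiv e, y} \<in> edges ?H"
      using edge[of "Orig v" "central_nbr G v w"] A v w e by auto
    then have "{Subdiv e, y} = central_edge G a b \<or> {Subdiv e, y} = central_edge G b a"
      using edges_at_Subdiv[OF G(1)] ab by blast
    then show "y \<in> {Orig a, Orig b}"
      by (auto simp: central_edge_def central_nbr_def doubleton_eq_iff split: if_splits)
  qed
  then have "card (\<phi> ` ?A) \<le> card {Orig a, Orig b}" by (intro card_mono) auto
  also have "\<dots> \<le> 2" by (simp add: card_insert_if)
  finally have "card (\<phi> ` ?A) \<le> 2" .
  moreover have "card (\<phi> ` ?A) = card (vertices G) - 1"
    using inj_on_subset[OF bij_betw_imp_inj_on[OF bij] A] v G(1)
    by (simp add: card_image central_nbr_inj finite_simple_graph_def)
  ultimately show False using G(2) by simp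
qed

text \<open>The color of \<open>v0\<close> has to be unique among original vertices only, as
  automorphisms map these to original vertices.\<close>

lemma distinguishing_central_graph:
  assumes G: "finite_simple_graph G" "connected_graph G" "4 \<le> card (vertices G)"
    and f: "proper_total_coloring (central_graph G) d f"
    and v0: "v0 \<in> vertices G"
    and unique: "\<And>v. v \<in> vertices G \<Longrightarrow> f (Inl (Orig v)) = f (Inl (Orig v0)) \<Longrightarrow> v = v0"
  shows "distinguishing (central_graph G) f"
  unfolding distinguishing_def
proof (intro allI impI ballI)
  let ?H = "central_graph G"
  fix \<phi> x assume "automorphism ?H \<phi> \<and> preserves_coloring ?H \<phi> f" and x: "x \<in> vertices ?H"
  then have \<phi>: "automorphism ?H \<phi>" "preserves_coloring ?H \<phi> f" by auto
  have half: "{Orig u, Subdiv {u, w}} \<in> edges ?H" if "w \<in> nbrs G u" for u w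
    using that by (auto simp: central_graph_def nbrs_def)
  obtain v1 where v1: "v1 \<in> vertices G" "\<phi> (Orig v0) = Orig v1"
    using automorphism_maps_Orig_to_Orig[OF G(1,3) \<phi>(1) v0] by blast
  have "f (Inl (\<phi> (Orig v0))) = f (Inl (Orig v0))"
    using \<phi>(2) v0 by (simp add: preserves_coloring_def)
  then have fix0: "\<phi> (Orig v0) = Orig v0" using unique v1 by metis
  have subdiv: "\<phi> (Subdiv {u, w}) = Subdiv {u, w}"
    if "\<phi> (Orig u) = Orig u" "w \<in> nbrs G u" "u \<in> vertices G" for u w
    by (rule automorphism_fixes_nbr[OF \<phi> f half[OF that(2)]]) (use that in \<open>auto simp: nbrs_def\<close>)
  \<comment> \<open>An edge of \<open>G\<close> is crossed in two steps: a fixed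
    \<open>Orig u\<close> forces the subdividing vertex to be fixed, and this forces
    \<open>Orig w\<close>.\<close>
  have orig: "v \<in> vertices G \<and> \<phi> (Orig v) = Orig v" if "v \<in> vertices G" for v
  proof (rule connected_induct[OF G(2) v0 that])
    show "v0 \<in> vertices G \<and> \<phi> (Orig v0) = Orig v0" using v0 fix0 by simp
    fix u w assume u: "u \<in> vertices G \<and> \<phi> (Orig u) = Orig u" and w: "w \<in> nbrs G u"
    have wV: "w \<in> vertices G" using w nbrs_subset[OF G(1)] by blast
    have "{Subdiv {u, w}, Orig w} \<in> edges ?H"
      using half[of u w] w nbrs_sym[of u G w] by (simp add: insert_commute)
    then have "\<phi> (Orig w) = Orig w"
      by (rule automorphism_fixes_nbr[OF \<phi> f]) (use subdiv u w wV in \<open>auto simp: nbrs_def\<close>)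
    with wV show "w \<in> vertices G \<and> \<phi> (Orig w) = Orig w" by simp
  qed
  show "\<phi> x = x"
  proof (cases x)
    case (Orig v)
    then show ?thesis using orig x by simp
  next
    case (Subdiv e)
    then have "e \<in> edges G" using x by simp
    then obtain u w where "e = {u, w}" "w \<in> nbrs G u" "u \<in> vertices G"
      using edge_cases[OF G(1)] by metis
    then show ?thesis using subdiv orig Subdiv by blast
  qed
qed

section \<open>Total colorings from symmetric Latin squares\<close>

text \<open>\<open>L\<close> acts as a symmetric Latin square. Edges between original vertices take
  their entry of \<open>L\<close>. In row \<open>v\<close> this leaves the entries of the closed
  neighborhood, one more than the degree of \<open>v\<close> in \<open>G\<close>: one is the color
  \<open>c v\<close>, and the others go to the half-edges at \<open>v\<close> by
  \<open>exists_conflict_free_assignment\<close>.\<close>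

lemma exists_proper_total_coloring_central_graph:
  fixes L :: "'a \<Rightarrow> 'a \<Rightarrow> nat"
  assumes G: "finite_simple_graph G" and n: "card (vertices G) = n" "5 \<le> n"
    and deg: "\<And>v. v \<in> vertices G \<Longrightarrow> 2 \<le> card (nbrs G v)"
    and L: "\<And>v w. v \<in> vertices G \<Longrightarrow> w \<in> vertices G \<Longrightarrow> L v w = L w v \<and> L v w < n"
    and L_inj: "\<And>v. v \<in> vertices G \<Longrightarrow> inj_on (L v) (vertices G)"
    and c: "\<And>v. v \<in> vertices G \<Longrightarrow> c v \<in> L v ` insert v (nbrs G v)"
    and c_ne: "\<And>v w. v \<in> vertices G \<Longrightarrow> w \<in> vertices G \<Longrightarrow> v \<noteq> w \<Longrightarrow> w \<notin> nbrs G v \<Longrightarrow> c v \<noteq> c w"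
  shows "\<exists>f. proper_total_coloring (central_graph G) n f \<and> (\<forall>v. f (Inl (Orig v)) = c v)"
proof -
  let ?V = "vertices G" and ?N = "nbrs G" and ?H = "central_graph G"
  have finV: "finite ?V" using G by (simp add: finite_simple_graph_def)
  have NV: "?N v \<subseteq> ?V" and irr: "v \<notin> ?N v" for v using nbrs_subset[OF G] nbrs_irrefl[OF G] by auto
  have finN: "finite (?N v)" for v using NV finV finite_subset by blast
  define R where "R v = L v ` insert v (?N v) - {c v}" for v
  have cR: "card (R v) = card (?N v)" if "v \<in> ?V" for v
  proof -
    have "inj_on (L v) (insert v (?N v))"
      using inj_on_subset[OF L_inj[OF that]] NV that by auto
    then have "card (L v ` insert v (?N v)) = Suc (card (?N v))"
      using irr finN by (simp add: card_image)
    then show ?thesis using c[OF that] finN by (simp add: R_def)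
  qed
  obtain \<sigma> where bij: "\<And>v. v \<in> ?V \<Longrightarrow> bij_betw (\<sigma> v) (?N v) (R v)"
    and ne: "\<And>v w. v \<in> ?V \<Longrightarrow> w \<in> ?N v \<Longrightarrow> \<sigma> v w \<noteq> \<sigma> w v"
  proof -
    have "\<exists>\<sigma>. (\<forall>v\<in>?V. bij_betw (\<sigma> v) (?N v) (R v)) \<and> (\<forall>v\<in>?V. \<forall>w\<in>?N v. \<sigma> v w \<noteq> \<sigma> w v)"
    proof (rule exists_conflict_free_assignment[OF finV NV _ irr deg])
      show "w \<in> ?N v \<Longrightarrow> v \<in> ?N w" for v w using nbrs_sym[of v G w] by simp
      show "v \<in> ?V \<Longrightarrow> finite (R v) \<and> card (R v) = card (?N v)" for v
        using cR finN by (simp add: R_def)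
    qed
    then show thesis using that by blast
  qed
  define k where "k v w = (if w \<in> ?N v then \<sigma> v w else L v w)" for v w
  have \<sigma>R: "\<sigma> v w \<in> R v" if "v \<in> ?V" "w \<in> ?N v" for v w
    using bij[OF that(1)] that(2) by (auto simp: bij_betw_def)
  have L_out: "L v w \<notin> L v ` insert v (?N v)" if "v \<in> ?V" "w \<in> ?V" "w \<noteq> v" "w \<notin> ?N v" for v w
    using inj_on_image_mem_iff[OF L_inj[OF that(1)] that(2), of "insert v (?N v)"] that NV by auto
  have L_less: "L v w < n" if "v \<in> ?V" "w \<in> insert v (?N v)" for v w
    using L that NV by blast
  have k_less: "k v w < n" if "v \<in> ?V" "w \<in> ?V" for v w
    using \<sigma>R[OF that(1), of w] L[OF that] L_less[OF that(1)] by (auto simp: k_def R_def)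
  have k_ne_c: "k v w \<noteq> c v" if "v \<in> ?V" "w \<in> ?V" "w \<noteq> v" for v w
    using \<sigma>R[OF that(1), of w] L_out[OF that] c[OF that(1)] by (auto simp: k_def R_def)
  have k_inj: "w = w'" if v: "v \<in> ?V" and w: "w \<in> ?V" "w \<noteq> v" "w' \<in> ?V" "w' \<noteq> v" and eq: "k v w = k v w'" for v w w'
  proof -
    consider "w \<in> ?N v" "w' \<in> ?N v" | "w \<notin> ?N v" "w' \<notin> ?N v" | "w \<in> ?N v \<longleftrightarrow> w' \<notin> ?N v" by blast
    then show ?thesis
    proof cases
      case 1
      then show ?thesis using bij[OF v] eq by (auto simp: k_def bij_betw_def dest: inj_onD)
    next
      case 2
      then show ?thesis using L_inj[OF v] eq w by (auto simp: k_def dest: inj_onD)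
    next
      case 3
      have "\<sigma> v x \<noteq> L v y" if "x \<in> ?N v" "y \<in> ?V" "y \<noteq> v" "y \<notin> ?N v" for x y
        using \<sigma>R[OF v that(1)] L_out[OF v that(2-4)] by (metis DiffD1 R_def)
      then show ?thesis using 3 eq w by (metis k_def)
    qed
  qed
  \<comment> \<open>The value is well defined: an edge determines \<open>v\<close> and
    \<open>w\<close> up to order, and both orders are possible only for nonadjacent pairs, where
    \<open>k\<close> is the symmetric \<open>L\<close>.\<close>
  define h where "h X = (THE y. \<exists>v\<in>?V. \<exists>w\<in>?V. v \<noteq> w \<and> X = central_edge G v w \<and> y = k v w)" for X
  have h: "h (central_edge G v w) = k v w" if "v \<in> ?V" "w \<in> ?V" "w \<noteq> v" for v w
    unfolding h_def
  proof (rule the_equality)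
    show "\<exists>v'\<in>?V. \<exists>w'\<in>?V. v' \<noteq> w' \<and> central_edge G v w = central_edge G v' w' \<and> k v w = k v' w'"
      using that by (intro bexI[of _ v] bexI[of _ w] conjI refl) auto
    fix y assume "\<exists>v'\<in>?V. \<exists>w'\<in>?V. v' \<noteq> w' \<and> central_edge G v w = central_edge G v' w' \<and> y = k v' w'"
    then obtain v' w' where "v' \<noteq> w'" "central_edge G v w = central_edge G v' w'" "y = k v' w'" by blast
    then show "y = k v w"
      using central_edge_eq[of G v w v' w'] that L[of v w] nbrs_sym[of v G w] by (auto simp: k_def)
  qed
  \<comment> \<open>At most four colors are forbidden at a subdividing vertex, those of its two
    neighbors and two edges. Subdividing vertices are pairwise nonadjacent, so each can choose among
    \<open>n \<ge> 5\<close> colors independently.\<close>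
  define bad where "bad e = c ` e \<union> h ` {X \<in> edges ?H. Subdiv e \<in> X}" for e
  have "\<exists>y<n. y \<notin> bad e" if e: "e \<in> edges G" for e
  proof -
    obtain u v where uv: "e = {u, v}" using edge_cases[OF G e] by metis
    let ?B = "{c u, c v, h (central_edge G u v), h (central_edge G v u)}"
    have sub: "bad e \<subseteq> ?B"
      using edges_at_Subdiv[OF G] by (auto simp: bad_def uv)
    have "card ?B \<le> 4" by (simp add: card_insert_if)
    then have "\<not> {..<n} \<subseteq> ?B" using card_mono[of ?B "{..<n}"] n by auto
    then show ?thesis using sub by blast
  qed
  then obtain t where t: "\<And>e. e \<in> edges G \<Longrightarrow> t e < n \<and> t e \<notin> bad e" by metis
  define f where "f = case_sum (case_central_vertex c t) h"
  have f_simps [simp]: "f (Inl (Orig v)) = c v" "f (Inl (Subdiv e)) = t e" "f (Inr X) = h X" for v e X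
    by (simp_all add: f_def)
  have c_less: "c v < n" if "v \<in> ?V" for v using c[OF that] L_less[OF that] by auto
  have edgeE: thesis if X: "X \<in> edges ?H" and r: "\<And>v w. X = central_edge G v w \<Longrightarrow> v \<in> ?V \<Longrightarrow> w \<in> ?V \<Longrightarrow> w \<noteq> v \<Longrightarrow> thesis" for X thesis
    using X r by (auto simp: edges_central_graph[OF G])
  have incident: "f (Inl x) \<noteq> h X" if x: "x \<in> vertices ?H" and X: "X \<in> edges ?H" "x \<in> X" for x X
  proof (cases x)
    case (Orig v)
    then have "v \<in> ?V" using x by simp
    moreover obtain w where "X = central_edge G v w" "w \<in> ?V" "w \<noteq> v"
      using edges_at_Orig[OF G \<open>v \<in> ?V\<close>] X Orig by blast
    ultimately show ?thesis using h k_ne_c[of v w] Orig by simp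
  next
    case (Subdiv e)
    then have "h X \<in> bad e" using X by (auto simp: bad_def)
    then show ?thesis using t[of e] x Subdiv by auto
  qed
  have adj_edges: "h X \<noteq> h Y" if X: "X \<in> edges ?H" and Y: "Y \<in> edges ?H" and XY: "X \<noteq> Y"
    and x: "x \<in> X" "x \<in> Y" for X Y x
  proof (cases x)
    case (Orig v)
    have v: "v \<in> ?V" using X x Orig
      by (elim edgeE) (auto simp: central_edge_def central_nbr_def split: if_splits)
    have *: "\<exists>w. Z = central_edge G v w \<and> w \<in> ?V \<and> w \<noteq> v" if "Z \<in> edges ?H" "Orig v \<in> Z" for Z
    proof -
      have "Z \<in> {Z \<in> edges ?H. Orig v \<in> Z}" using that by simp
      then show ?thesis unfolding edges_at_Orig[OF G v] by blast
    qed
    obtain w w' where w: "X = central_edge G v w" "w \<in> ?V" "w \<noteq> v"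
      and w': "Y = central_edge G v w'" "w' \<in> ?V" "w' \<noteq> v"
      using *[OF X] *[OF Y] x Orig by blast
    show ?thesis using h[OF v w(2,3)] h[OF v w'(2,3)] k_inj[OF v w(2,3) w'(2,3)] w(1) w'(1) XY by auto
  next
    case (Subdiv e)
    obtain u v where uv: "e = {u, v}" "v \<in> ?N u" "u \<in> ?V" "v \<in> ?V" "u \<noteq> v"
    proof -
      have "e \<in> edges G" using X x Subdiv
        by (elim edgeE) (auto simp: central_edge_def central_nbr_def nbrs_def split: if_splits)
      then show thesis using edge_cases[OF G] that by metis
    qed
    have "{X, Y} = {central_edge G u v, central_edge G v u}"
      using edges_at_Subdiv[OF G X] edges_at_Subdiv[OF G Y] x Subdiv uv(1) XY by blast
    moreover have "h (central_edge G u v) \<noteq> h (central_edge G v u)"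
      using h uv ne nbrs_sym[of v G u] by (simp add: k_def)
    ultimately show ?thesis by (auto simp: doubleton_eq_iff)
  qed
  have adj_vertices: "f (Inl x) \<noteq> f (Inl y)" if xy: "{x, y} \<in> edges ?H" for x y
  proof -
    obtain v w where X: "{x, y} = central_edge G v w" "v \<in> ?V" "w \<in> ?V" "w \<noteq> v"
      using edgeE[OF xy] by metis
    have "f (Inl (Orig v)) \<noteq> f (Inl (central_nbr G v w))"
    proof (cases "w \<in> ?N v")
      case True
      then have "c v \<in> bad {v, w}" "{v, w} \<in> edges G" by (auto simp: bad_def nbrs_def)
      then show ?thesis using t[of "{v, w}"] True by (auto simp: central_nbr_def)
    next
      case False
      then show ?thesis using c_ne X by (auto simp: central_nbr_def)
    qed
    then show ?thesis using X(1) by (auto simp: central_edge_def doubleton_eq_iff)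
  qed
  have "f x < n" if "x \<in> vertices ?H <+> edges ?H" for x
    using that
  proof
    fix y assume "x = Inl y" "y \<in> vertices ?H"
    then show "f x < n" using c_less t by (cases y) auto
  next
    fix X assume "x = Inr X" "X \<in> edges ?H"
    then show "f x < n" using h k_less by (auto elim!: edgeE)
  qed
  moreover have "\<forall>X\<in>edges ?H. \<forall>Y\<in>edges ?H. X \<noteq> Y \<and> X \<inter> Y \<noteq> {} \<longrightarrow> f (Inr X) \<noteq> f (Inr Y)"
    using adj_edges by (metis disjoint_iff f_simps(3))
  ultimately have "proper_total_coloring ?H n f"
    unfolding proper_total_coloring_def using adj_vertices incident by simp
  then show ?thesis using f_simps(1) by blast
qed


section \<open>Labels modulo the order\<close>

lemma add_mod_cancel:
  fixes a b x n :: nat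
  assumes "a < n" "b < n" "(x + a) mod n = (x + b) mod n"
  shows "a = b"
  using assms
proof (induction a b rule: linorder_wlog)
  case (le a b)
  then have "n dvd (x + b) - (x + a)" using mod_eq_dvd_iff_nat[of "x + a" "x + b" n] by simp
  then have "n dvd b - a" by simp
  then show ?case using le by (meson dvd_imp_le less_imp_diff_less not_le zero_less_diff le_neq_implies_less)
qed simp

text \<open>The factor 2 is coprime to \<open>n\<close> and can be cancelled.\<close>

lemma double_mod_inj:
  fixes a b n :: nat
  assumes "odd n" "a < n" "b < n" "(a + a) mod n = (b + b) mod n"
  shows "a = b"
  using assms(2-)
proof (induction a b rule: linorder_wlog)
  case (le a b)
  then have "n dvd (b + b) - (a + a)" using mod_eq_dvd_iff_nat[of "a + a" "b + b" n] by simp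
  moreover have "(b + b) - (a + a) = 2 * (b - a)" by simp
  ultimately have "n dvd 2 * (b - a)" by metis
  moreover have "coprime n 2" using assms(1) by simp
  ultimately have "n dvd b - a" by (simp add: coprime_dvd_mult_right_iff)
  then show ?case using le by (meson dvd_imp_le less_imp_diff_less not_le zero_less_diff le_neq_implies_less)
qed simp

text \<open>Sums of labels modulo \<open>n\<close> form a symmetric Latin square. So it suffices to
  find labels \<open>l\<close>, vertex colors \<open>c\<close> taken from the entries of closed
  neighborhoods that separate nonadjacent vertices, and a vertex \<open>v0\<close> whose color is
  unique.\<close>

lemma exists_distinguishing_total_coloring:
  assumes G: "finite_simple_graph G" "connected_graph G" "regular_graph G"
    and n: "card (vertices G) = n" "5 \<le> n"
  shows "\<exists>f. proper_total_coloring (central_graph G) n f \<and> distinguishing (central_graph G) f"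
proof -
  let ?V = "vertices G" and ?N = "nbrs G"
  have finV: "finite ?V" using G(1) by (simp add: finite_simple_graph_def)
  obtain k where deg: "\<And>v. v \<in> ?V \<Longrightarrow> card (?N v) = k"
    using G(3) card_nbrs[OF G(1)] by (auto simp: regular_graph_def)
  have k: "2 \<le> k" using connected_regular_degree_ge_2[OF G(1,2) _ deg] n by simp
  have NV: "?N v \<subseteq> ?V" for v by (rule nbrs_subset[OF G(1)])
  have "\<exists>l c v0. bij_betw l ?V {..<n} \<and>
      (\<forall>v\<in>?V. \<exists>w\<in>insert v (?N v). c v = (l v + l w) mod n) \<and>
      (\<forall>v\<in>?V. \<forall>w\<in>?V. v \<noteq> w \<and> w \<notin> ?N v \<longrightarrow> c v \<noteq> c w) \<and>
      v0 \<in> ?V \<and> (\<forall>v\<in>?V. c v = c v0 \<longrightarrow> v = v0)"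
  proof (cases "odd n")
    case True
    obtain l where l: "bij_betw l ?V {..<n}"
      using ex_bij_betw_finite_nat[OF finV] n by (auto simp: atLeast0LessThan)
    \<comment> \<open>These colors are pairwise distinct, so every vertex can serve as
      \<open>v0\<close>.\<close>
    define c where "c v = (l v + l v) mod n" for v
    have "v = w" if "v \<in> ?V" "w \<in> ?V" "c v = c w" for v w
    proof -
      have "l v < n" "l w < n" using l that by (auto simp: bij_betw_def)
      then have "l v = l w" using double_mod_inj[OF True] that(3) unfolding c_def by blast
      then show ?thesis using inj_onD[OF bij_betw_imp_inj_on[OF l]] that by blast
    qed
    moreover obtain v0 where "v0 \<in> ?V" using n by fastforce
    ultimately show ?thesis using l by (intro exI[of _ l] exI[of _ c] exI[of _ v0]) (auto simp: c_def)
  next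
    case False
    have V0: "?V \<noteq> {}" and ev: "even (card ?V)" using n False by auto
    have sym: "w \<in> ?N v \<Longrightarrow> v \<in> ?N w" for v w using nbrs_sym[of v G w] by simp
    obtain cs where cs: "column_list ?N cs" "fst ` set cs \<union> snd ` set cs = ?V"
      and first: "1 < length cs" "snd (cs ! 1) \<in> ?N (snd (cs ! 0))"
      using exists_column_list[OF finV V0 NV sym nbrs_irrefl[OF G(1)] deg k ev] by blast
    define h where "h = length cs"
    \<comment> \<open>The label of a vertex is its position in \<open>ls\<close>: first components
      of columns get \<open>0\<close> to \<open>h - 1\<close>, second components \<open>h\<close> to
      \<open>2 * h - 1\<close>, where \<open>h\<close> is half of \<open>n\<close>.\<close>
    define ls where "ls = map fst cs @ map snd cs"
    have ls: "distinct ls" "set ls = ?V" "length ls = 2 * h"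
      using cs by (auto simp: ls_def column_list_def h_def)
    have n2: "n = 2 * h" using ls n distinct_card by metis
    have x: "ls ! j = fst (cs ! j)" and y: "ls ! (h + j) = snd (cs ! j)" if "j < h" for j
      using that by (simp_all add: ls_def h_def nth_append)
    have bij: "bij_betw ((!) ls) {..<n} ?V" using bij_betw_nth[OF ls(1)] ls n2 by simp
    define l where "l = inv_into {..<n} ((!) ls)"
    have l: "bij_betw l ?V {..<n}" using bij_betw_inv_into[OF bij] by (simp add: l_def)
    have l_nth: "l (ls ! i) = i" if "i < n" for i
      using bij that by (simp add: l_def bij_betw_inv_into_left)
    \<comment> \<open>Where consecutive second components are adjacent, the earlier one takes the
      odd color. In every other column \<open>column_list\<close> makes the two entries adjacent, so
      both may take \<open>2 * j\<close>.\<close>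
    define odd_col where "odd_col j \<longleftrightarrow> Suc j < h \<and> snd (cs ! Suc j) \<in> ?N (snd (cs ! j))" for j
    define c where "c v = (if l v < h then 2 * l v else 2 * (l v - h) + (if odd_col (l v - h) then 1 else 0))" for v
    have cx: "c (ls ! j) = 2 * j" and cy: "c (ls ! (h + j)) = 2 * j + (if odd_col j then 1 else 0)" if "j < h" for j
      using that l_nth[of j] l_nth[of "h + j"] n2 by (simp_all add: c_def)
    have cases: thesis
      if v: "v \<in> ?V" and "\<And>j. v = ls ! j \<Longrightarrow> j < h \<Longrightarrow> thesis" "\<And>j. v = ls ! (h + j) \<Longrightarrow> j < h \<Longrightarrow> thesis"
      for v thesis
    proof -
      obtain i where i: "v = ls ! i" "i < 2 * h" using v ls by (metis in_set_conv_nth)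
      then show thesis using that(2)[of i] that(3)[of "i - h"] by (cases "i < h") auto
    qed
    have A1: "\<exists>w\<in>insert v (?N v). c v = (l v + l w) mod n" if v: "v \<in> ?V" for v
      using v
    proof (rule cases)
      fix j assume j: "v = ls ! j" "j < h"
      then show ?thesis using cx[of j] l_nth[of j] n2 by auto
    next
      fix j assume j: "v = ls ! (h + j)" "j < h"
      have lv: "l v = h + j" using j l_nth n2 by simp
      show ?thesis
      proof (cases "odd_col j")
        case True
        let ?w = "ls ! (h + Suc j)"
        have "Suc j < h" "?w \<in> ?N v" using True j y[of j] y[of "Suc j"] by (auto simp: odd_col_def)
        then have "l ?w = h + Suc j" using l_nth n2 by simp
        then have "l v + l ?w = 2 * j + 1 + n" using lv n2 by simp
        moreover have "2 * j + 1 < n" using \<open>Suc j < h\<close> n2 by simp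
        ultimately have "(l v + l ?w) mod n = 2 * j + 1" by (metis mod_add_self2 mod_less)
        then show ?thesis using cy[OF j(2)] True j \<open>?w \<in> ?N v\<close> by (metis insertCI)
      next
        case False
        have "l v + l v = 2 * j + n" using lv n2 by simp
        moreover have "2 * j < n" using j n2 by simp
        ultimately have "(l v + l v) mod n = 2 * j" by (metis mod_add_self2 mod_less)
        then show ?thesis using cy[OF j(2)] False j by auto
      qed
    qed
    \<comment> \<open>Halving the color recovers the column, so equal colors occur only for the two
      entries of a column without odd color, and these are adjacent.\<close>
    have A2: "c v \<noteq> c w" if v: "v \<in> ?V" and w: "w \<in> ?V" and vw: "v \<noteq> w" "w \<notin> ?N v" for v w
    proof
      assume eq: "c v = c w"
      have adj: "ls ! (h + j) \<in> ?N (ls ! j)" if "j < h" "\<not> odd_col j" for j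
        using cs(1) that x y by (auto simp: column_list_def odd_col_def h_def)
      from v show False
      proof (rule cases)
        fix i assume i: "v = ls ! i" "i < h"
        from w show False
        proof (rule cases)
          fix j assume "w = ls ! j" "j < h"
          then show False using eq i cx vw by simp
        next
          fix j assume j: "w = ls ! (h + j)" "j < h"
          then have "2 * i = 2 * j + (if odd_col j then 1 else 0)" using eq i cx cy by simp
          then have "i = j \<and> \<not> odd_col j" by (auto split: if_splits) presburger
          then show False using adj[of j] i j vw by simp
        qed
      next
        fix i assume i: "v = ls ! (h + i)" "i < h"
        from w show False
        proof (rule cases)
          fix j assume j: "w = ls ! j" "j < h"
          then have "2 * j = 2 * i + (if odd_col i then 1 else 0)" using eq i cx cy by simp
          then have "i = j \<and> \<not> odd_col i" by (auto split: if_splits) presburger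
          then show False using sym[OF adj[of j]] i j vw by auto
        next
          fix j assume j: "w = ls ! (h + j)" "j < h"
          then have "2 * i + (if odd_col i then 1 else 0) = 2 * j + (if odd_col j then 1 else 0)"
            using eq i cy by simp
          then have "i = j" by (auto split: if_splits)
          then show False using i j vw by blast
        qed
      qed
    qed
    \<comment> \<open>The condition on the first two columns makes the second entry of column 0,
      which is \<open>ls ! h\<close>, the only vertex of color 1.\<close>
    have h0: "0 < h" and "odd_col 0" using first by (auto simp: odd_col_def h_def)
    then have A3: "ls ! h \<in> ?V" using nth_mem[of h ls] ls by simp
    have A4: "v = ls ! h" if v: "v \<in> ?V" and eq: "c v = c (ls ! h)" for v
    proof -
      have "c (ls ! h) = 1" using cy[OF h0] \<open>odd_col 0\<close> by simp
      then have c1: "c v = 1" using eq by simp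
      from v show ?thesis
      proof (rule cases)
        fix j assume "v = ls ! j" "j < h"
        then have "2 * j = 1" using c1 cx[of j] by simp
        then have False by presburger
        then show ?thesis ..
      next
        fix j assume "v = ls ! (h + j)" "j < h"
        then show ?thesis using c1 cy[of j] by (auto split: if_splits)
      qed
    qed
    have "\<forall>v\<in>?V. \<exists>w\<in>insert v (?N v). c v = (l v + l w) mod n" using A1 by blast
    moreover have "\<forall>v\<in>?V. \<forall>w\<in>?V. v \<noteq> w \<and> w \<notin> ?N v \<longrightarrow> c v \<noteq> c w" using A2 by blast
    moreover have "\<forall>v\<in>?V. c v = c (ls ! h) \<longrightarrow> v = ls ! h" using A4 by blast
    ultimately show ?thesis using l A3 by iprover
  qed
  then obtain l c v0 where l: "bij_betw l ?V {..<n}"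
    and c: "\<forall>v\<in>?V. \<exists>w\<in>insert v (?N v). c v = (l v + l w) mod n"
    and c_ne: "\<forall>v\<in>?V. \<forall>w\<in>?V. v \<noteq> w \<and> w \<notin> ?N v \<longrightarrow> c v \<noteq> c w"
    and v0: "v0 \<in> ?V" "\<forall>v\<in>?V. c v = c v0 \<longrightarrow> v = v0" by iprover
  have inj: "inj_on (\<lambda>w. (l v + l w) mod n) ?V" for v
  proof (rule inj_onI)
    fix w w' assume w: "w \<in> ?V" "w' \<in> ?V" "(l v + l w) mod n = (l v + l w') mod n"
    then have "l w < n" "l w' < n" using l by (auto simp: bij_betw_def)
    then have "l w = l w'" using add_mod_cancel w(3) by blast
    then show "w = w'" using inj_onD[OF bij_betw_imp_inj_on[OF l]] w by blast
  qed
  have "\<exists>f. proper_total_coloring (central_graph G) n f \<and> (\<forall>v. f (Inl (Orig v)) = c v)"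
  proof (rule exists_proper_total_coloring_central_graph[OF G(1) n])
    show "2 \<le> card (?N v)" if "v \<in> ?V" for v using deg[OF that] k by simp
    show "(l v + l w) mod n = (l w + l v) mod n \<and> (l v + l w) mod n < n" for v w
      using n(2) by (simp add: add.commute)
    show "c v \<in> (\<lambda>w. (l v + l w) mod n) ` insert v (?N v)" if "v \<in> ?V" for v
      using c that by blast
    show "c v \<noteq> c w" if "v \<in> ?V" "w \<in> ?V" "v \<noteq> w" "w \<notin> ?N v" for v w
      using c_ne that by blast
  qed (rule inj)
  then obtain f where f: "proper_total_coloring (central_graph G) n f" "\<And>v. f (Inl (Orig v)) = c v"
    by blast
  have "distinguishing (central_graph G) f"
    by (rule distinguishing_central_graph[OF G(1,2) _ f(1) v0(1)]) (use n f(2) v0(2) in auto)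
  with f(1) show ?thesis by blast
qed

text \<open>Both chromatic numbers equal \<open>n\<close>: a single distinguishing coloring with
  \<open>n\<close> colors bounds them from above, and the degree \<open>n - 1\<close> of an original
  vertex bounds them from below.\<close>

theorem theorem4p5:
  fixes G :: "'a graph" and n :: nat
  assumes "finite_simple_graph G"
    and "connected_graph G"
    and "regular_graph G"
    and "graph_order G = n"
    and "n \<ge> 5"
  shows "(odd n \<longrightarrow>
            total_distinguishing_chromatic_number (central_graph G)
              = max_degree (central_graph G) + 1)
       \<and> (even n \<and> \<not> graph_isomorphic G (complete_graph n)
            \<and> real (max_degree G) \<le> (2 * real n - 29) / 6 \<longrightarrow>
            total_distinguishing_chromatic_number (central_graph G)
              = max_degree (central_graph G) + 1)
       \<and> (odd n \<or> (even n \<and> \<not> graph_isomorphic G (complete_graph n)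
            \<and> real (max_degree G) \<le> (2 * real n - 29) / 6) \<longrightarrow>
            total_chromatic_number (central_graph G)
              = max_degree (central_graph G) + 1)"
proof -
  let ?H = "central_graph G"
  have n: "card (vertices G) = n" "5 \<le> n" using assms(4,5) by (auto simp: graph_order_def)
  obtain f where f: "proper_total_coloring ?H n f" "distinguishing ?H f"
    using exists_distinguishing_total_coloring[OF assms(1-3) n] by blast
  have lower: "n \<le> d" if "proper_total_coloring ?H d g" for d g
  proof -
    obtain v where v: "v \<in> vertices G" using n by fastforce
    have "finite (vertices G)" using assms(1) by (simp add: finite_simple_graph_def)
    then have "finite (edges ?H)" by (simp add: edges_central_graph[OF assms(1)])
    then have "vertex_degree ?H (Orig v) < d"
      using proper_total_coloring_lower_bound[OF that] v by simp
    then show ?thesis using vertex_degree_Orig[OF assms(1) v] n by simp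
  qed
  have "max_degree ?H + 1 = n" using max_degree_central_graph[OF assms(1)] n by simp
  moreover have "total_distinguishing_chromatic_number ?H = n"
    unfolding total_distinguishing_chromatic_number_def
    by (rule Least_equality) (use f lower in blast)+
  moreover have "total_chromatic_number ?H = n"
    unfolding total_chromatic_number_def by (rule Least_equality) (use f lower in blast)+
  ultimately show ?thesis by simp
qed

end
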